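(* Let $\Sigma=(n,Q,\{(A_q,B_q,C_q)\mid q\in Q\})$ be an LSS, in continuous or in discrete time. (1) If $\mathcal{P}$ is a positive semi-definite matrix which satisfies, for all $q\in Q$, $A_q\mathcal{P}+\mathcal{P}A_q^T+B_qB_q^T\le0$ (in continuous time), resp. $A_q\mathcal{P}A_q^T+B_qB_q^T-\mathcal{P}\le0$ (in discrete time), and $\Sigma$ is span-reachable, then $\mathcal{P}$ is positive definite. (2) If $\mathcal{R}$ is a positive semi-definite matrix which satisfies, for all $q\in Q$, $A_q^T\mathcal{R}+\mathcal{R}A_q+C_q^TC_q\le0$ (in continuous time), resp. $A_q^T\mathcal{R}A_q+C_q^TC_q-\mathcal{R}\le0$ (in discrete time), and $\Sigma$ is observable, then $\mathcal{R}$ is positive definite.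
   Context: Let $Q=\{1,\ldots,D\}$, $D\ge1$. A linear switched system (LSS) is a tuple $\Sigma=(n,Q,\{(A_q,B_q,C_q)\mid q\in Q\})$ with $A_q\in\mathbb{R}^{n\times n}$, $B_q\in\mathbb{R}^{n\times m}$, $C_q\in\mathbb{R}^{p\times n}$. In continuous time, with $T=[0,\infty)$, inputs are $u\in\mathcal{U}=L_2(T,\mathbb{R}^m)$, switching signals are $q\in\mathcal{Q}=PC(T,Q)$ (piecewise continuous: finitely many discontinuities on each compact interval, with one-sided limits), states are absolutely continuous functions. In discrete time, $\mathcal{U}=l_2(\mathbb{N},\mathbb{R}^m)$ and $\mathcal{Q}$ is the set of infinite sequences in $Q$. For $x_0\in\mathbb{R}^n$ and $(u,q)\in\mathcal{U}\times\mathcal{Q}$, let $X^\Sigma_{x_0}(u,q)=x$ and $Y^\Sigma_{x_0}(u,q)=y$ be given by $\delta x(t)=A_{q(t)}x(t)+B_{q(t)}u(t)$ (a.e. in continuous time), $x(0)=x_0$, $y(t)=C_{q(t)}x(t)$, with $\delta x=\dot x$ in continuous time and $\delta x(t)=x(t+1)$ in discrete time. $\Sigma$ is observable if $x_1\ne x_2$ implies $Y^\Sigma_{x_1}\ne Y^\Sigma_{x_2}$ as maps on $\mathcal{U}\times\mathcal{Q}$. $\Sigma$ is span-reachable if the linear span of the reachable set $\{X^\Sigma_0(u,q)(t)\mid u\in\mathcal{U},\,q\in\mathcal{Q},\,t\}$ is $\mathbb{R}^n$. Inequalities between symmetric matrices refer to definiteness. *)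

theory Defs
  imports "HOL-Analysis.Analysis"
begin

section \<open>Definiteness\<close>

text \<open>The order on \<open>real ^ 'n ^ 'n\<close> in the library is componentwise, so the
  semidefinite order is spelled out here.\<close>

definition pos_semidef :: "real ^ 'n ^ 'n \<Rightarrow> bool" where
  "pos_semidef M \<longleftrightarrow> transpose M = M \<and> (\<forall>x. 0 \<le> x \<bullet> (M *v x))"

definition pos_def :: "real ^ 'n ^ 'n \<Rightarrow> bool" where
  "pos_def M \<longleftrightarrow> transpose M = M \<and> (\<forall>x. x \<noteq> 0 \<longrightarrow> 0 < x \<bullet> (M *v x))"

definition neg_semidef :: "real ^ 'n ^ 'n \<Rightarrow> bool" where
  "neg_semidef M \<longleftrightarrow> transpose M = M \<and> (\<forall>x. x \<bullet> (M *v x) \<le> 0)"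

section \<open>Linear switched systems\<close>

text \<open>The dimensions \<open>n\<close>, \<open>m\<close>, \<open>p\<close> of state, input and output are the cardinalities of the
  index types. Only the values of the matrix families on \<open>modes \<Sigma>\<close> matter.\<close>

record ('n, 'm, 'p) lss =
  num_modes :: nat
  Amat :: "nat \<Rightarrow> real ^ 'n::finite ^ 'n"
  Bmat :: "nat \<Rightarrow> real ^ 'm::finite ^ 'n"
  Cmat :: "nat \<Rightarrow> real ^ 'n ^ 'p::finite"

definition modes :: "('n::finite, 'm::finite, 'p::finite) lss \<Rightarrow> nat set" where
  "modes \<Sigma> = {1..num_modes \<Sigma>}"

section \<open>Continuous time\<close>

text \<open>Signals are functions on all of \<open>real\<close> of which only the restriction to the time axis
  \<open>{0..}\<close> is relevant. Inputs are square-integrable functions, not equivalence classes: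
  the trajectories below depend on an input only up to null sets.\<close>

definition ct_inputs :: "(real \<Rightarrow> real ^ 'm) set" where
  "ct_inputs = {u. u \<in> borel_measurable (lebesgue_on {0..}) \<and>
                   integrable (lebesgue_on {0..}) (\<lambda>t. (norm (u t))\<^sup>2)}"

definition ct_switching :: "nat set \<Rightarrow> (real \<Rightarrow> nat) set" where
  "ct_switching Q = {q. (\<forall>t\<ge>0. q t \<in> Q) \<and>
     (\<forall>b\<ge>0. finite {t \<in> {0..b}. \<not> continuous (at t within {0..}) q}) \<and>
     (\<forall>t>0. \<exists>l. (q \<longlongrightarrow> l) (at_left t)) \<and>
     (\<forall>t\<ge>0. \<exists>l. (q \<longlongrightarrow> l) (at_right t))}"

definition absolutely_continuous_on_interval ::
    "real \<Rightarrow> real \<Rightarrow> (real \<Rightarrow> 'a::real_normed_vector) \<Rightarrow> bool" where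
  "absolutely_continuous_on_interval a b f \<longleftrightarrow>
     (\<forall>\<epsilon>>0. \<exists>\<delta>>0. \<forall>D. finite D \<longrightarrow>
        (\<forall>(s, t)\<in>D. a \<le> s \<and> s < t \<and> t \<le> b) \<longrightarrow>
        disjoint_family_on (\<lambda>(s, t). {s<..<t}) D \<longrightarrow>
        (\<Sum>(s, t)\<in>D. t - s) < \<delta> \<longrightarrow>
        (\<Sum>(s, t)\<in>D. norm (f t - f s)) < \<epsilon>)"

text \<open>On the unbounded time axis absolute continuity means absolute continuity on every
  compact interval; the uniform version would already exclude \<open>exp\<close> as a state trajectory.

  The state and output maps are represented by the set of solutions, respectively of the
  output functions on \<open>{0..}\<close>, belonging to given \<open>x0\<close>, \<open>u\<close>, \<open>q\<close>.  By the Caratheodory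
  theory of linear equations the solution exists and is unique on \<open>{0..}\<close>, so that
  \<open>ct_output \<Sigma> x0 u q\<close> is the singleton of the output response.\<close>

definition ct_state ::
    "('n::finite, 'm::finite, 'p::finite) lss \<Rightarrow> real ^ 'n \<Rightarrow> (real \<Rightarrow> real ^ 'm) \<Rightarrow> (real \<Rightarrow> nat)
      \<Rightarrow> (real \<Rightarrow> real ^ 'n) set" where
  "ct_state \<Sigma> x0 u q = {x.
     (\<forall>b\<ge>0. absolutely_continuous_on_interval 0 b x) \<and> x 0 = x0 \<and>
     (AE t in lebesgue_on {0..}.
        (x has_vector_derivative (Amat \<Sigma> (q t) *v x t + Bmat \<Sigma> (q t) *v u t))
          (at t within {0..}))}"

definition ct_output ::
    "('n::finite, 'm::finite, 'p::finite) lss \<Rightarrow> real ^ 'n \<Rightarrow> (real \<Rightarrow> real ^ 'm) \<Rightarrow> (real \<Rightarrow> nat)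
      \<Rightarrow> (real \<Rightarrow> real ^ 'p) set" where
  "ct_output \<Sigma> x0 u q = (\<lambda>x. \<lambda>t\<in>{0..}. Cmat \<Sigma> (q t) *v x t) ` ct_state \<Sigma> x0 u q"

definition ct_observable :: "('n::finite, 'm::finite, 'p::finite) lss \<Rightarrow> bool" where
  "ct_observable \<Sigma> \<longleftrightarrow> (\<forall>x1 x2. x1 \<noteq> x2 \<longrightarrow>
     (\<exists>u \<in> ct_inputs. \<exists>q \<in> ct_switching (modes \<Sigma>). ct_output \<Sigma> x1 u q \<noteq> ct_output \<Sigma> x2 u q))"

definition ct_reachable :: "('n::finite, 'm::finite, 'p::finite) lss \<Rightarrow> (real ^ 'n) set" where
  "ct_reachable \<Sigma> = {x t | x u q t.
     u \<in> ct_inputs \<and> q \<in> ct_switching (modes \<Sigma>) \<and> x \<in> ct_state \<Sigma> 0 u q \<and> 0 \<le> t}"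

definition ct_span_reachable :: "('n::finite, 'm::finite, 'p::finite) lss \<Rightarrow> bool" where
  "ct_span_reachable \<Sigma> \<longleftrightarrow> span (ct_reachable \<Sigma>) = UNIV"

section \<open>Discrete time\<close>

definition dt_inputs :: "(nat \<Rightarrow> real ^ 'm) set" where
  "dt_inputs = {u. summable (\<lambda>t. (norm (u t))\<^sup>2)}"

definition dt_switching :: "nat set \<Rightarrow> (nat \<Rightarrow> nat) set" where
  "dt_switching Q = {q. \<forall>t. q t \<in> Q}"

primrec dt_state ::
    "('n::finite, 'm::finite, 'p::finite) lss \<Rightarrow> real ^ 'n \<Rightarrow> (nat \<Rightarrow> real ^ 'm) \<Rightarrow> (nat \<Rightarrow> nat)
      \<Rightarrow> nat \<Rightarrow> real ^ 'n" where
  "dt_state \<Sigma> x0 u q 0 = x0"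
| "dt_state \<Sigma> x0 u q (Suc t) =
     Amat \<Sigma> (q t) *v dt_state \<Sigma> x0 u q t + Bmat \<Sigma> (q t) *v u t"

definition dt_output ::
    "('n::finite, 'm::finite, 'p::finite) lss \<Rightarrow> real ^ 'n \<Rightarrow> (nat \<Rightarrow> real ^ 'm) \<Rightarrow> (nat \<Rightarrow> nat)
      \<Rightarrow> nat \<Rightarrow> real ^ 'p" where
  "dt_output \<Sigma> x0 u q = (\<lambda>t. Cmat \<Sigma> (q t) *v dt_state \<Sigma> x0 u q t)"

definition dt_observable :: "('n::finite, 'm::finite, 'p::finite) lss \<Rightarrow> bool" where
  "dt_observable \<Sigma> \<longleftrightarrow> (\<forall>x1 x2. x1 \<noteq> x2 \<longrightarrow>
     (\<exists>u \<in> dt_inputs. \<exists>q \<in> dt_switching (modes \<Sigma>). dt_output \<Sigma> x1 u q \<noteq> dt_output \<Sigma> x2 u q))"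

definition dt_reachable :: "('n::finite, 'm::finite, 'p::finite) lss \<Rightarrow> (real ^ 'n) set" where
  "dt_reachable \<Sigma> = {dt_state \<Sigma> 0 u q t | u q t.
     u \<in> dt_inputs \<and> q \<in> dt_switching (modes \<Sigma>)}"

definition dt_span_reachable :: "('n::finite, 'm::finite, 'p::finite) lss \<Rightarrow> bool" where
  "dt_span_reachable \<Sigma> \<longleftrightarrow> span (dt_reachable \<Sigma>) = UNIV"

end

theory Submission
  imports Defs
begin

text \<open>
  The Lyapunov inequalities make the kernel of \<open>R\<close> a set of unobservable states and the orthogonal
  complement of the kernel of \<open>P\<close> a set that no input can leave; observability and reachability
  then force these kernels to be trivial.

  For observability, let \<open>R *v v = 0\<close>. Evaluating the Lyapunov inequality at \<open>v\<close> gives \<open>C v = 0\<close> and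
  \<open>R (A v) = 0\<close> for every mode (\<open>ct_lyapunov_kernel\<close>, \<open>dt_lyapunov_kernel\<close>). So the kernel of \<open>R\<close> is
  invariant under all \<open>A\<close> and invisible to all \<open>C\<close>: for every switching signal the free motion from
  \<open>v\<close> stays in the kernel and gives output \<open>0\<close>, hence \<open>v\<close> cannot be distinguished from \<open>0\<close>. For
  reachability, the same computation with transposes shows that the kernel of \<open>P\<close> is invariant under all
  \<open>transpose A\<close> and annihilated by all \<open>transpose B\<close>. Dually, the orthogonal complement of the kernel
  is invariant under all \<open>A\<close> and contains the ranges of all \<open>B\<close>, so it contains every reachable
  state. If these span the whole space, the kernel is trivial. A positive semidefinite matrix with
  trivial kernel is positive definite.

  In discrete time the statements about trajectories are inductions. In continuous time a
  trajectory is only absolutely continuous and satisfies the equation almost everywhere, and two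
  facts have to be supplied. That an invariant subspace is not left
  (\<open>ct_state_in_invariant_subspace\<close>) is a Gronwall argument for the component of the state
  orthogonal to the subspace. It rests on a mean value inequality for absolutely continuous
  functions (\<open>absolutely_continuous_mean_value\<close>), which is obtained from gauges in the manner of
  Henstock, without Lebesgue integrals. That free motions exist for every switching signal
  (\<open>ct_homogeneous_state_exists\<close>) is needed because \<open>ct_output\<close> is a set of output functions: to
  identify the sets for two initial states, a trajectory from one must be turned into a
  trajectory from the other. Free motions are exponentials joined at the switching times.
\<close>

section \<open>Absolutely continuous functions\<close>

text \<open>The mean value inequality survives an exceptional null set \<open>N\<close> because \<open>f\<close> is absolutely
  continuous. Take a tagged division that is fine for the following gauge. Around a tag outside
  \<open>N\<close> the difference quotient is close to the derivative, so an interval with this tag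
  contributes at most \<open>M + e\<close> times its length. Around a tag in \<open>N\<close> the gauge stays inside an
  open superset \<open>T\<close> of \<open>N\<close> of measure less than \<open>d\<close>, so the intervals with such tags have total
  length less than \<open>d\<close>, and absolute continuity bounds their total contribution by \<open>e\<close>.\<close>

lemma absolutely_continuous_mean_value:
  fixes f :: "real \<Rightarrow> 'a::real_normed_vector"
  assumes "a \<le> b" and ac: "absolutely_continuous_on_interval a b f"
    and N: "negligible N" and M: "0 \<le> M"
    and der: "\<And>t. t \<in> {a..b} - N \<Longrightarrow>
      \<exists>f'. (f has_vector_derivative f') (at t within {a..b}) \<and> norm f' \<le> M"
  shows "norm (f b - f a) \<le> M * (b - a)"
proof -
  have approx: "norm (f b - f a) \<le> (M + e) * (b - a) + e" if e: "e > 0" for e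
  proof -
    obtain d where d: "d > 0" and dD: "\<And>D. finite D \<Longrightarrow> \<forall>(s, t)\<in>D. a \<le> s \<and> s < t \<and> t \<le> b \<Longrightarrow>
        disjoint_family_on (\<lambda>(s, t). {s<..<t}) D \<Longrightarrow> (\<Sum>(s, t)\<in>D. t - s) < d \<Longrightarrow>
        (\<Sum>(s, t)\<in>D. norm (f t - f s)) < e"
      using ac e unfolding absolutely_continuous_on_interval_def by meson
    have Nl: "N \<in> sets lebesgue" "emeasure lebesgue N = 0"
      using N by (auto simp: negligible_iff_null_sets null_sets_def)
    obtain T where T: "open T" "N \<subseteq> T" "T - N \<in> lmeasurable" "emeasure lebesgue (T - N) < ennreal d"
      using sets_lebesgue_outer_open[OF Nl(1) d] by blast
    have "T = (T - N) \<union> N" using T by auto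
    then have emT: "emeasure lebesgue T = emeasure lebesgue (T - N)"
      using T(3) Nl by (metis emeasure_Un_null_set fmeasurableD null_setsI)
    have Tl: "T \<in> lmeasurable"
      using T emT by (auto simp: fmeasurable_def)
    have mT: "measure lebesgue T < d"
      using T(4) emT Tl by (metis emeasure_eq_measure2 ennreal_less_iff measure_nonneg)
    have "\<exists>r>0. (t \<in> N \<longrightarrow> ball t r \<subseteq> T) \<and> (t \<in> {a..b} - N \<longrightarrow>
        (\<forall>c d. c \<in> {a..b} \<and> d \<in> {a..b} \<and> c \<le> t \<and> t \<le> d \<and> dist c t < r \<and> dist d t < r \<longrightarrow>
           norm (f d - f c) \<le> (M + e) * (d - c)))" for t
    proof (cases "t \<in> {a..b} - N")
      case True
      from der[OF this] obtain f' where f': "(f has_vector_derivative f') (at t within {a..b})" "norm f' \<le> M"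
        by blast
      then obtain r where r: "r > 0" and rb: "\<And>y. y \<in> {a..b} \<Longrightarrow> norm (y - t) < r \<Longrightarrow>
          norm (f y - f t - (y - t) *\<^sub>R f') \<le> e * norm (y - t)"
        using e unfolding has_vector_derivative_def has_derivative_within_alt by blast
      have *: "norm (f d - f c) \<le> (M + e) * (d - c)"
        if h: "c \<in> {a..b}" "d \<in> {a..b}" "c \<le> t" "t \<le> d" "dist c t < r" "dist d t < r" for c d
      proof -
        have rc: "norm (f c - f t - (c - t) *\<^sub>R f') \<le> e * (t - c)"
          and rd: "norm (f d - f t - (d - t) *\<^sub>R f') \<le> e * (d - t)"
          using rb[of c] rb[of d] h by (auto simp: dist_norm)
        have "norm ((d - c) *\<^sub>R f') \<le> (d - c) * M"
          using h f'(2) by (auto intro!: mult_mono)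
        moreover have "f d - f c = (f d - f t - (d - t) *\<^sub>R f') - (f c - f t - (c - t) *\<^sub>R f')
            + (d - c) *\<^sub>R f'"
          by (simp add: algebra_simps)
        ultimately have "norm (f d - f c) \<le> e * (d - t) + e * (t - c) + (d - c) * M"
          using rc rd by (smt (verit) norm_triangle_ineq norm_triangle_ineq4)
        then show ?thesis by (simp add: algebra_simps)
      qed
      then show ?thesis using r True by (intro exI[of _ r]) auto
    next
      case False
      show ?thesis
      proof (cases "t \<in> N")
        case True
        then show ?thesis using T(1,2) False by (meson DiffE openE subset_iff)
      next
        case False2: False
        then show ?thesis using False by (intro exI[of _ 1]) auto
      qed
    qed
    then obtain r where r: "\<And>t. r t > 0" and rN: "\<And>t. t \<in> N \<Longrightarrow> ball t (r t) \<subseteq> T"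
      and rD: "\<And>t c d. t \<in> {a..b} - N \<Longrightarrow> c \<in> {a..b} \<Longrightarrow> d \<in> {a..b} \<Longrightarrow> c \<le> t \<Longrightarrow> t \<le> d \<Longrightarrow>
         dist c t < r t \<Longrightarrow> dist d t < r t \<Longrightarrow> norm (f d - f c) \<le> (M + e) * (d - c)"
      by metis
    have "gauge (\<lambda>t. ball t (r t))" using r by (simp add: gauge_ball_dependent)
    then obtain p where p: "p tagged_division_of {a..b}" and fine: "(\<lambda>t. ball t (r t)) fine p"
      using fine_division_exists_real by blast
    have pfin: "finite p" using p by blast
    have pK: "\<exists>c d. K = {c..d} \<and> c \<le> t \<and> t \<le> d \<and> a \<le> c \<and> d \<le> b \<and> Inf K = c \<and> Sup K = d
        \<and> {c..d} \<subseteq> ball t (r t)" if tK: "(t, K) \<in> p" for t K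
    proof -
      have "t \<in> K" "K \<subseteq> {a..b}" "\<exists>c d. K = cbox c d"
        using p tK by (auto simp: tagged_division_of)
      moreover have "K \<subseteq> ball t (r t)" using fine tK by (auto simp: fine_def)
      ultimately show ?thesis by (fastforce simp: subset_iff)
    qed
    let ?len = "\<lambda>(t, K). Sup K - Inf K :: real"
    let ?df = "\<lambda>(t, K). norm (f (Sup K) - f (Inf K))"
    \<comment> \<open>Degenerate intervals are left out: they contribute nothing, and without them the map
      to end points is injective.\<close>
    define pN where "pN = {(t, K) \<in> p. t \<in> N \<and> Inf K < Sup K}"
    define D where "D = (\<lambda>(t, K). (Inf K, Sup K)) ` pN"
    have pNp: "pN \<subseteq> p" by (auto simp: pN_def)
    have disj: "{Inf K<..<Sup K} \<inter> {Inf K'<..<Sup K'} = {}"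
      if "(t, K) \<in> p" "(t', K') \<in> p" "(t, K) \<noteq> (t', K')" for t K t' K'
    proof -
      have "interior K \<inter> interior K' = {}"
        using p that unfolding tagged_division_of by blast
      moreover have "{Inf K<..<Sup K} = interior K" "{Inf K'<..<Sup K'} = interior K'"
        using pK[OF that(1)] pK[OF that(2)] by (metis interior_atLeastAtMost_real)+
      ultimately show ?thesis by simp
    qed
    have inj: "inj_on (\<lambda>(t, K). (Inf K, Sup K)) pN"
    proof (rule inj_onI, clarsimp)
      fix t K t' K' assume h: "(t, K) \<in> pN" "(t', K') \<in> pN" "Inf K = Inf K'" "Sup K = Sup K'"
      then have "{Inf K<..<Sup K} \<noteq> {}" by (auto simp: pN_def)
      with disj[of t K t' K'] h show "t = t' \<and> K = K'" by (auto simp: pN_def)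
    qed
    have Dfin: "finite D" using pfin pNp by (auto simp: D_def intro: finite_subset)
    have Din: "\<forall>(s, t)\<in>D. a \<le> s \<and> s < t \<and> t \<le> b"
      using pK by (fastforce simp: D_def pN_def)
    have Ddisj: "disjoint_family_on (\<lambda>(s, t). {s<..<t}) D"
      unfolding disjoint_family_on_def
    proof (intro ballI impI)
      fix i j assume "i \<in> D" "j \<in> D" "i \<noteq> j"
      moreover from this obtain t K t' K' where "(t, K) \<in> pN" "i = (Inf K, Sup K)"
        "(t', K') \<in> pN" "j = (Inf K', Sup K')" unfolding D_def by auto
      ultimately show "(\<lambda>(s, t). {s<..<t}) i \<inter> (\<lambda>(s, t). {s<..<t}) j = {}"
        using disj[of t K t' K'] pNp by blast
    qed
    have "(\<Sum>(s, t)\<in>D. t - s) = (\<Sum>i\<in>D. measure lebesgue ((\<lambda>(s, t). {s<..<t}) i))"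
      using Din by (intro sum.cong) auto
    also have "\<dots> = measure lebesgue (\<Union>i\<in>D. (\<lambda>(s, t). {s<..<t}) i)"
    proof (rule measure_finite_Union[symmetric, OF Dfin _ Ddisj])
      fix i assume "i \<in> D"
      then show "emeasure lebesgue ((\<lambda>(s, t). {s<..<t}) i) \<noteq> \<infinity>"
        using Din by (cases i) (force simp: emeasure_lborel_Ioo)
    qed auto
    also have "\<dots> \<le> measure lebesgue T"
    proof (rule measure_mono_fmeasurable[OF _ _ Tl])
      show "(\<Union>i\<in>D. (\<lambda>(s, t). {s<..<t}) i) \<subseteq> T"
      proof (clarsimp simp: D_def)
        fix x t K assume h: "(t, K) \<in> pN" "Inf K < x" "x < Sup K"
        then have "x \<in> ball t (r t)" "t \<in> N" using pK[of t K] by (fastforce simp: pN_def)+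
        then show "x \<in> T" using rN by blast
      qed
      show "(\<Union>i\<in>D. (\<lambda>(s, t). {s<..<t}) i) \<in> sets lebesgue"
        using Dfin by (intro sets.finite_UN) (auto split: prod.splits)
    qed
    finally have "(\<Sum>(s, t)\<in>D. norm (f t - f s)) < e"
      using dD[OF Dfin Din Ddisj] mT by linarith
    moreover have "(\<Sum>(s, t)\<in>D. norm (f t - f s)) = sum ?df pN"
      unfolding D_def by (subst sum.reindex[OF inj]) (auto intro: sum.cong)
    ultimately have sN: "sum ?df pN < e" by simp
    have len: "sum ?len p = b - a"
      using additive_tagged_division_1[OF \<open>a \<le> b\<close> p, of "\<lambda>x. x"] by simp
    have sD: "sum ?df (p - pN) \<le> sum (\<lambda>i. (M + e) * ?len i) (p - pN)"
    proof (rule sum_mono, clarify)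
      fix t K assume h: "(t, K) \<in> p" "(t, K) \<notin> pN"
      obtain c d where cd: "K = {c..d}" "c \<le> t" "t \<le> d" "a \<le> c" "d \<le> b" "Inf K = c" "Sup K = d"
        "{c..d} \<subseteq> ball t (r t)" using pK[OF h(1)] by blast
      have "c \<in> ball t (r t)" "d \<in> ball t (r t)" by (rule subsetD[OF cd(8)], use cd in simp)+
      then have dd: "dist c t < r t" "dist d t < r t" by (auto simp: dist_commute)
      show "norm (f (Sup K) - f (Inf K)) \<le> (M + e) * (Sup K - Inf K)"
      proof (cases "t \<in> N")
        case True
        then have "c = d" using h cd by (auto simp: pN_def)
        then show ?thesis using cd by simp
      next
        case False
        then show ?thesis using rD[of t c d] cd dd by auto
      qed
    qed
    have "f b - f a = (\<Sum>(t, K)\<in>p. f (Sup K) - f (Inf K))"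
      using additive_tagged_division_1[OF \<open>a \<le> b\<close> p] by metis
    also have "norm \<dots> \<le> sum ?df p" by (rule sum_norm_le) auto
    also have "\<dots> = sum ?df (p - pN) + sum ?df pN" by (rule sum.subset_diff[OF pNp pfin])
    also have "\<dots> \<le> sum (\<lambda>i. (M + e) * ?len i) (p - pN) + e" using sN sD by linarith
    also have "\<dots> \<le> sum (\<lambda>i. (M + e) * ?len i) p + e"
    proof (intro add_right_mono sum_mono2[OF pfin])
      fix i assume "i \<in> p - (p - pN)"
      then show "0 \<le> (M + e) * ?len i" using M e by (auto simp: pN_def split: prod.splits)
    qed auto
    also have "\<dots> = (M + e) * (b - a) + e" using len by (simp add: sum_distrib_left[symmetric])
    finally show ?thesis .
  qed
  show ?thesis
  proof (rule field_le_epsilon)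
    fix e :: real assume e: "e > 0"
    let ?e = "e / (b - a + 1)"
    have "?e > 0" using e \<open>a \<le> b\<close> by simp
    from approx[OF this] have "norm (f b - f a) \<le> M * (b - a) + ?e * (b - a + 1)"
      by (simp only: distrib_left distrib_right mult_1_right add.assoc)
    then show "norm (f b - f a) \<le> M * (b - a) + e" using \<open>a \<le> b\<close> by simp
  qed
qed

lemma absolutely_continuous_imp_continuous:
  assumes "absolutely_continuous_on_interval a b f"
  shows "continuous_on {a..b} f"
  unfolding continuous_on_iff
proof (intro ballI allI impI)
  fix x e :: real assume x: "x \<in> {a..b}" and e: "0 < e"
  obtain d where d: "d > 0" and dD: "\<And>D. finite D \<Longrightarrow> \<forall>(s, t)\<in>D. a \<le> s \<and> s < t \<and> t \<le> b \<Longrightarrow>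
      disjoint_family_on (\<lambda>(s, t). {s<..<t}) D \<Longrightarrow> (\<Sum>(s, t)\<in>D. t - s) < d \<Longrightarrow>
      (\<Sum>(s, t)\<in>D. norm (f t - f s)) < e"
    using assms e unfolding absolutely_continuous_on_interval_def by meson
  have *: "norm (f t - f s) < e" if "a \<le> s" "s < t" "t \<le> b" "t - s < d" for s t
    using dD[of "{(s, t)}"] that by (simp add: disjoint_family_on_def)
  have "dist (f y) (f x) < e" if "y \<in> {a..b}" "dist y x < d" for y
    using *[of x y] *[of y x] x that e
    by (cases x y rule: linorder_cases) (auto simp: dist_norm norm_minus_commute)
  then show "\<exists>d>0. \<forall>x'\<in>{a..b}. dist x' x < d \<longrightarrow> dist (f x') (f x) < e"
    using d by blast
qed

lemma absolutely_continuous_subinterval: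
  assumes "absolutely_continuous_on_interval a b f" "a \<le> c" "d \<le> b"
  shows "absolutely_continuous_on_interval c d f"
  unfolding absolutely_continuous_on_interval_def
proof (intro allI impI)
  fix e :: real assume "e > 0"
  then obtain \<delta> where d: "\<delta> > 0" and dD: "\<And>D. finite D \<Longrightarrow> \<forall>(s, t)\<in>D. a \<le> s \<and> s < t \<and> t \<le> b \<Longrightarrow>
      disjoint_family_on (\<lambda>(s, t). {s<..<t}) D \<Longrightarrow> (\<Sum>(s, t)\<in>D. t - s) < \<delta> \<Longrightarrow>
      (\<Sum>(s, t)\<in>D. norm (f t - f s)) < e"
    using assms(1) unfolding absolutely_continuous_on_interval_def by meson
  have "(\<Sum>(s, t)\<in>D. norm (f t - f s)) < e"
    if "finite D" "\<forall>(s, t)\<in>D. c \<le> s \<and> s < t \<and> t \<le> d"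
      "disjoint_family_on (\<lambda>(s, t). {s<..<t}) D" "(\<Sum>(s, t)\<in>D. t - s) < \<delta>" for D
    by (rule dD) (use that assms(2,3) in fastforce)+
  then show "\<exists>\<delta>>0. \<forall>D. finite D \<longrightarrow> (\<forall>(s, t)\<in>D. c \<le> s \<and> s < t \<and> t \<le> d) \<longrightarrow>
      disjoint_family_on (\<lambda>(s, t). {s<..<t}) D \<longrightarrow> (\<Sum>(s, t)\<in>D. t - s) < \<delta> \<longrightarrow>
      (\<Sum>(s, t)\<in>D. norm (f t - f s)) < e"
    using d by blast
qed

text \<open>Two dominating functions suffice for the closure properties that are used: sums, images under
  a bounded linear map, and, with the identity as dominating function, Lipschitz functions.\<close>

lemma absolutely_continuous_dominated:
  assumes f: "absolutely_continuous_on_interval a b f"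
    and g: "absolutely_continuous_on_interval a b g"
    and le: "\<And>s t. a \<le> s \<Longrightarrow> s < t \<Longrightarrow> t \<le> b \<Longrightarrow> norm (h t - h s) \<le> C * (norm (f t - f s) + norm (g t - g s))"
  shows "absolutely_continuous_on_interval a b h"
  unfolding absolutely_continuous_on_interval_def
proof (intro allI impI)
  fix e :: real assume e: "e > 0"
  define e' where "e' = e / (\<bar>C\<bar> + 1) / 2"
  have e': "e' > 0" using e by (simp add: e'_def)
  have "e' + e' = e / (\<bar>C\<bar> + 1)" unfolding e'_def by (rule field_sum_of_halves)
  then have C: "(\<bar>C\<bar> + 1) * (e' + e') = e" by simp
  obtain d1 where d1: "d1 > 0" and D1: "\<And>D. finite D \<Longrightarrow> \<forall>(s, t)\<in>D. a \<le> s \<and> s < t \<and> t \<le> b \<Longrightarrow>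
      disjoint_family_on (\<lambda>(s, t). {s<..<t}) D \<Longrightarrow> (\<Sum>(s, t)\<in>D. t - s) < d1 \<Longrightarrow>
      (\<Sum>(s, t)\<in>D. norm (f t - f s)) < e'"
    using f e' unfolding absolutely_continuous_on_interval_def by meson
  obtain d2 where d2: "d2 > 0" and D2: "\<And>D. finite D \<Longrightarrow> \<forall>(s, t)\<in>D. a \<le> s \<and> s < t \<and> t \<le> b \<Longrightarrow>
      disjoint_family_on (\<lambda>(s, t). {s<..<t}) D \<Longrightarrow> (\<Sum>(s, t)\<in>D. t - s) < d2 \<Longrightarrow>
      (\<Sum>(s, t)\<in>D. norm (g t - g s)) < e'"
    using g e' unfolding absolutely_continuous_on_interval_def by meson
  have "(\<Sum>(s, t)\<in>D. norm (h t - h s)) < e"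
    if D: "finite D" "\<forall>(s, t)\<in>D. a \<le> s \<and> s < t \<and> t \<le> b"
      "disjoint_family_on (\<lambda>(s, t). {s<..<t}) D" "(\<Sum>(s, t)\<in>D. t - s) < min d1 d2" for D
  proof -
    have "(\<Sum>(s, t)\<in>D. norm (h t - h s))
        \<le> (\<Sum>(s, t)\<in>D. (\<bar>C\<bar> + 1) * (norm (f t - f s) + norm (g t - g s)))"
    proof (rule sum_mono, clarify)
      fix s t assume "(s, t) \<in> D"
      then have "norm (h t - h s) \<le> C * (norm (f t - f s) + norm (g t - g s))"
        using le D(2) by blast
      also have "\<dots> \<le> (\<bar>C\<bar> + 1) * (norm (f t - f s) + norm (g t - g s))"
        by (intro mult_right_mono) auto
      finally show "norm (h t - h s) \<le> (\<bar>C\<bar> + 1) * (norm (f t - f s) + norm (g t - g s))" .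
    qed
    also have "\<dots> = (\<bar>C\<bar> + 1) * ((\<Sum>(s, t)\<in>D. norm (f t - f s)) + (\<Sum>(s, t)\<in>D. norm (g t - g s)))"
      by (simp add: sum_distrib_left[symmetric] sum.distrib[symmetric] case_prod_unfold)
    also have "\<dots> < (\<bar>C\<bar> + 1) * (e' + e')"
      using D1[OF D(1-3)] D2[OF D(1-3)] D(4) by (intro mult_strict_left_mono add_strict_mono) auto
    finally show ?thesis using C by simp
  qed
  moreover have "min d1 d2 > 0" using d1 d2 by simp
  ultimately show "\<exists>\<delta>>0. \<forall>D. finite D \<longrightarrow> (\<forall>(s, t)\<in>D. a \<le> s \<and> s < t \<and> t \<le> b) \<longrightarrow>
      disjoint_family_on (\<lambda>(s, t). {s<..<t}) D \<longrightarrow> (\<Sum>(s, t)\<in>D. t - s) < \<delta> \<longrightarrow>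
      (\<Sum>(s, t)\<in>D. norm (h t - h s)) < e"
    by blast
qed

lemma absolutely_continuous_ident: "absolutely_continuous_on_interval a b (\<lambda>t. t)"
  unfolding absolutely_continuous_on_interval_def
proof (intro allI impI)
  fix e :: real assume "e > 0"
  moreover have "(\<Sum>(s, t)\<in>D. norm (t - s)) = (\<Sum>(s, t)\<in>D. t - s)"
    if "\<forall>(s, t)\<in>D. a \<le> s \<and> s < t \<and> t \<le> b" for D
    using that by (intro sum.cong) auto
  ultimately show "\<exists>\<delta>>0. \<forall>D. finite D \<longrightarrow> (\<forall>(s, t)\<in>D. a \<le> s \<and> s < t \<and> t \<le> b) \<longrightarrow>
      disjoint_family_on (\<lambda>(s, t). {s<..<t}) D \<longrightarrow> (\<Sum>(s, t)\<in>D. t - s) < \<delta> \<longrightarrow>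
      (\<Sum>(s, t)\<in>D. norm (t - s)) < e"
    by (intro exI[of _ e]) auto
qed

section \<open>Invariant subspaces of trajectories\<close>

text \<open>On an interval of length less than \<open>1 / (2 * k)\<close> that starts at a zero of \<open>f\<close>, the mean value
  inequality bounds the maximum of the norm of \<open>f\<close> by half of itself, so \<open>f\<close> vanishes there.
  Bisection carries the zero from \<open>0\<close> to \<open>T\<close>.\<close>

lemma absolutely_continuous_gronwall_zero:
  fixes f :: "real \<Rightarrow> 'a::real_normed_vector"
  assumes ac: "\<And>b. 0 \<le> b \<Longrightarrow> absolutely_continuous_on_interval 0 b f" and f0: "f 0 = 0"
    and der: "AE t in lebesgue_on {0..}.
      \<exists>f'. (f has_vector_derivative f') (at t within {0..}) \<and> norm f' \<le> K * norm (f t)"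
    and "0 \<le> T"
  shows "f T = 0"
proof -
  define k where "k = max K 1"
  have k: "k \<ge> 1" "K \<le> k" by (auto simp: k_def)
  have "AE t in lebesgue. t \<in> {0..} \<longrightarrow>
      (\<exists>f'. (f has_vector_derivative f') (at t within {0..}) \<and> norm f' \<le> K * norm (f t))"
    using der by (subst (asm) AE_restrict_space_iff) auto
  then obtain N where N: "negligible N" "\<And>t. t \<ge> 0 \<Longrightarrow> t \<notin> N \<Longrightarrow>
      \<exists>f'. (f has_vector_derivative f') (at t within {0..}) \<and> norm f' \<le> K * norm (f t)"
    unfolding eventually_ae_filter_negligible by fastforce
  have short: "f b = 0" if ab: "0 \<le> a" "a \<le> b" "b - a < 1 / (2 * k)" and fa: "f a = 0" for a b
  proof -
    have acab: "absolutely_continuous_on_interval a b f"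
      by (rule absolutely_continuous_subinterval[OF ac[of b]]) (use ab in auto)
    have "continuous_on {a..b} (\<lambda>t. norm (f t))"
      using absolutely_continuous_imp_continuous[OF acab] by (intro continuous_intros)
    then obtain s where s: "s \<in> {a..b}" and smax: "\<And>t. t \<in> {a..b} \<Longrightarrow> norm (f t) \<le> norm (f s)"
      using continuous_attains_sup[of "{a..b}"] ab by fastforce
    have "norm (f s - f a) \<le> (k * norm (f s)) * (s - a)"
    proof (rule absolutely_continuous_mean_value[OF _ _ N(1)])
      show "absolutely_continuous_on_interval a s f"
        by (rule absolutely_continuous_subinterval[OF acab]) (use s in auto)
      fix t assume t: "t \<in> {a..s} - N"
      then obtain f' where f': "(f has_vector_derivative f') (at t within {0..})" "norm f' \<le> K * norm (f t)"
        using N(2)[of t] ab by auto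
      have "norm f' \<le> k * norm (f t)"
        using f'(2) k by (meson mult_right_mono norm_ge_zero order_trans)
      also have "\<dots> \<le> k * norm (f s)"
        using smax[of t] t s k by (intro mult_left_mono) auto
      finally show "\<exists>f'. (f has_vector_derivative f') (at t within {a..s}) \<and> norm f' \<le> k * norm (f s)"
        using has_vector_derivative_within_subset[OF f'(1), of "{a..s}"] ab by auto
    qed (use s k in auto)
    also have "\<dots> \<le> (k * norm (f s)) * (1 / (2 * k))"
      using s ab k by (intro mult_left_mono) auto
    also have "\<dots> = norm (f s) / 2" using k by simp
    finally have "norm (f s) \<le> 0" using fa by simp
    then show ?thesis using smax[of b] ab by auto
  qed
  let ?P = "\<lambda>a b. 0 \<le> a \<and> f a = 0 \<longrightarrow> f b = 0"
  have "?P 0 T"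
  proof (rule Bolzano[of 0 T ?P, OF \<open>0 \<le> T\<close>])
    show "\<exists>d>0. \<forall>a b. a \<le> x \<and> x \<le> b \<and> b - a < d \<longrightarrow> ?P a b" for x
      using short k by (intro exI[of _ "1 / (2 * k)"]) auto
  qed auto
  then show ?thesis using f0 by simp
qed

text \<open>The map is the orthogonal projection onto the complement of \<open>W\<close>. It measures how far a
  trajectory has left \<open>W\<close>, and \<open>x - L x \<in> W\<close> is what makes it compatible with maps that preserve \<open>W\<close>.\<close>

lemma linear_with_kernel:
  fixes W :: "'a::euclidean_space set"
  assumes W: "subspace W"
  obtains L :: "'a \<Rightarrow> 'a" where "linear L" "\<And>x. x - L x \<in> W" "\<And>x. L x = 0 \<longleftrightarrow> x \<in> W"
proof -
  obtain B where B: "B \<subseteq> W" "pairwise orthogonal B" "independent B" "span B = W"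
    by (rule orthogonal_basis_subspace[OF W])
  have fin: "finite B" using B(3) by (rule independent_imp_finite)
  define L where "L x = x - (\<Sum>b\<in>B. (b \<bullet> x / (b \<bullet> b)) *\<^sub>R b)" for x
  have lin: "linear L"
    by (rule linearI)
       (simp_all add: L_def inner_add_right add_divide_distrib scaleR_add_left sum.distrib
         scaleR_right_diff_distrib scaleR_sum_right)
  have diff: "x - L x \<in> W" for x
    using B(1) W by (auto simp: L_def intro!: subspace_sum subspace_scale)
  have orth: "orthogonal w (L x)" if "w \<in> W" for w x
    unfolding L_def using Gram_Schmidt_step[OF B(2), of w x] that B(4) by simp
  have "L x = 0 \<longleftrightarrow> x \<in> W" for x
  proof
    assume "L x = 0" then show "x \<in> W" using diff[of x] by simp
  next
    assume "x \<in> W"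
    then have "L x \<in> W" using subspace_diff[OF W _ diff[of x]] by force
    from orth[OF this, of x] show "L x = 0" by (simp add: orthogonal_def)
  qed
  then show thesis using that lin diff by blast
qed

lemma finite_linear_family_bound:
  fixes f :: "'i \<Rightarrow> 'a::euclidean_space \<Rightarrow> 'b::real_normed_vector"
  assumes "finite I" and lin: "\<And>i. i \<in> I \<Longrightarrow> linear (f i)"
  obtains M where "0 \<le> M" "\<And>i x. i \<in> I \<Longrightarrow> norm (f i x) \<le> M * norm x"
proof -
  have "\<exists>K. \<forall>x. norm (f i x) \<le> K * norm x" if "i \<in> I" for i
    using linear_bounded[OF lin[OF that]] by blast
  then obtain K where K: "\<And>i x. i \<in> I \<Longrightarrow> norm (f i x) \<le> K i * norm x" by metis
  define M where "M = (\<Sum>i\<in>I. \<bar>K i\<bar>)"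
  have "norm (f i x) \<le> M * norm x" if i: "i \<in> I" for i x
  proof -
    have "\<bar>K i\<bar> \<le> M" unfolding M_def using i \<open>finite I\<close> by (intro member_le_sum) auto
    then have "K i * norm x \<le> M * norm x" by (intro mult_right_mono) auto
    with K[OF i] show ?thesis by (rule order_trans)
  qed
  then show thesis using that[of M] by (simp add: M_def sum_nonneg)
qed

lemma finite_modes: "finite (modes \<Sigma>)"
  by (simp add: modes_def)

text \<open>Let \<open>L\<close> have kernel \<open>W\<close>. The input acts inside \<open>W\<close>, so \<open>L\<close> does not see it, and since \<open>A\<close> maps
  \<open>x - L x \<in> W\<close> into \<open>W\<close>, the derivative \<open>L (A x) = L (A (L x))\<close> of \<open>L x\<close> is bounded by a multiple
  of \<open>L x\<close> itself. As there are finitely many modes, the factor does not depend on the mode.\<close>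

lemma ct_state_in_invariant_subspace:
  fixes \<Sigma> :: "('n::finite, 'm::finite, 'p::finite) lss"
  assumes W: "subspace W"
    and AW: "\<And>q x. q \<in> modes \<Sigma> \<Longrightarrow> x \<in> W \<Longrightarrow> Amat \<Sigma> q *v x \<in> W"
    and q: "\<And>t. 0 \<le> t \<Longrightarrow> q t \<in> modes \<Sigma>"
    and BW: "\<And>t. 0 \<le> t \<Longrightarrow> Bmat \<Sigma> (q t) *v u t \<in> W"
    and x: "x \<in> ct_state \<Sigma> x0 u q" and x0: "x0 \<in> W" and "0 \<le> t"
  shows "x t \<in> W"
proof -
  obtain L where L: "linear L" "\<And>x. x - L x \<in> W" "\<And>x. L x = 0 \<longleftrightarrow> x \<in> W"
    using linear_with_kernel[OF W] by metis
  interpret L: bounded_linear L using L(1) by (rule linear_conv_bounded_linear[THEN iffD1])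
  obtain C where C: "\<And>x. norm (L x) \<le> norm x * C" using L.bounded by blast
  have "linear (\<lambda>x. L (Amat \<Sigma> i *v x))" for i
    using linear_compose[OF matrix_vector_mul_linear L(1)] by (simp add: o_def)
  then obtain M where M: "\<And>i x. i \<in> modes \<Sigma> \<Longrightarrow> norm (L (Amat \<Sigma> i *v x)) \<le> M * norm x"
    using finite_linear_family_bound[of "modes \<Sigma>" "\<lambda>i x. L (Amat \<Sigma> i *v x)"] finite_modes
    by metis
  have LA: "norm (L (Amat \<Sigma> i *v x)) \<le> M * norm (L x)" if i: "i \<in> modes \<Sigma>" for i x
  proof -
    have "L (Amat \<Sigma> i *v (x - L x)) = 0" using L(2,3) AW[OF i] by blast
    then have "L (Amat \<Sigma> i *v x) = L (Amat \<Sigma> i *v L x)"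
      by (simp add: matrix_vector_mult_diff_distrib L.diff)
    then show ?thesis using M[OF i] by metis
  qed
  have "L (x t) = 0"
  proof (rule absolutely_continuous_gronwall_zero[of "\<lambda>t. L (x t)" M, OF _ _ _ \<open>0 \<le> t\<close>])
    fix b :: real assume "0 \<le> b"
    then have "absolutely_continuous_on_interval 0 b x" using x by (auto simp: ct_state_def)
    then show "absolutely_continuous_on_interval 0 b (\<lambda>t. L (x t))"
    proof (rule absolutely_continuous_dominated[OF _ absolutely_continuous_ident])
      fix s t :: real assume "s < t"
      have "norm (L (x t) - L (x s)) \<le> norm (x t - x s) * C"
        using C[of "x t - x s"] by (simp add: L.diff)
      also have "\<dots> \<le> norm (x t - x s) * \<bar>C\<bar>" by (intro mult_left_mono) auto
      also have "\<dots> \<le> \<bar>C\<bar> * (norm (x t - x s) + norm (t - s))" by (simp add: distrib_left)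
      finally show "norm (L (x t) - L (x s)) \<le> \<bar>C\<bar> * (norm (x t - x s) + norm (t - s))" .
    qed
  next
    show "L (x 0) = 0" using x x0 L(3) by (auto simp: ct_state_def)
  next
    have "AE t in lebesgue_on {0..}.
        (x has_vector_derivative (Amat \<Sigma> (q t) *v x t + Bmat \<Sigma> (q t) *v u t)) (at t within {0..})"
      using x by (auto simp: ct_state_def)
    then show "AE t in lebesgue_on {0..}. \<exists>f'. ((\<lambda>t. L (x t)) has_vector_derivative f')
        (at t within {0..}) \<and> norm f' \<le> M * norm (L (x t))"
    proof (rule AE_mp, intro AE_I2 impI)
      fix t assume t: "t \<in> space (lebesgue_on {0::real..})"
        and d: "(x has_vector_derivative (Amat \<Sigma> (q t) *v x t + Bmat \<Sigma> (q t) *v u t)) (at t within {0..})"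
      then have t0: "0 \<le> t" by simp
      have "L (Bmat \<Sigma> (q t) *v u t) = 0" using BW[OF t0] L(3) by blast
      then have "((\<lambda>t. L (x t)) has_vector_derivative L (Amat \<Sigma> (q t) *v x t)) (at t within {0..})"
        using L.has_vector_derivative[OF d] by (simp add: L.add)
      then show "\<exists>f'. ((\<lambda>t. L (x t)) has_vector_derivative f')
        (at t within {0..}) \<and> norm f' \<le> M * norm (L (x t))"
        using LA[OF q[OF t0]] by blast
    qed
  qed
  then show ?thesis using L(3) by blast
qed

section \<open>Linear equations with piecewise constant coefficients\<close>

text \<open>The solution is the exponential series, applied to \<open>w\<close>. It is differentiated one coordinate at
  a time, because there it is a real power series.\<close>

lemma linear_ode_solution:
  fixes A :: "'a::euclidean_space \<Rightarrow> 'a" and w :: 'a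
  assumes "linear A"
  obtains z where "z s = w" "\<And>t. (z has_vector_derivative A (z t)) (at t)"
proof -
  interpret A: bounded_linear A using assms by (rule linear_conv_bounded_linear[THEN iffD1])
  obtain K where K: "K > 0" "\<And>x. norm (A x) \<le> norm x * K" using A.pos_bounded by blast
  have bound: "norm ((A ^^ n) w) \<le> norm w * K ^ n" for n
  proof (induction n)
    case (Suc n)
    have "norm (A ((A ^^ n) w)) \<le> norm ((A ^^ n) w) * K" by (rule K(2))
    also have "\<dots> \<le> (norm w * K ^ n) * K" using Suc K(1) by (intro mult_right_mono) auto
    finally show ?case by (simp add: mult_ac)
  qed simp
  have sm: "summable (\<lambda>n. (t ^ n / fact n) *\<^sub>R (A ^^ n) w)" for t :: real
  proof (rule summable_comparison_test)
    show "summable (\<lambda>n. norm w * ((\<bar>t\<bar> * K) ^ n /\<^sub>R fact n))"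
      by (intro summable_mult summable_exp_generic)
    have "norm ((t ^ n / fact n) *\<^sub>R (A ^^ n) w) \<le> norm w * ((\<bar>t\<bar> * K) ^ n /\<^sub>R fact n)" for n
    proof -
      have "\<bar>t\<bar> ^ n / fact n * norm ((A ^^ n) w) \<le> \<bar>t\<bar> ^ n / fact n * (norm w * K ^ n)"
        using bound by (intro mult_left_mono) auto
      then show ?thesis by (simp add: power_abs power_mult_distrib field_simps)
    qed
    then show "\<exists>N. \<forall>n\<ge>N. norm ((t ^ n / fact n) *\<^sub>R (A ^^ n) w) \<le> norm w * ((\<bar>t\<bar> * K) ^ n /\<^sub>R fact n)"
      by blast
  qed
  define e where "e t = (\<Sum>n. (t ^ n / fact n) *\<^sub>R (A ^^ n) w)" for t :: real
  have e0: "e 0 = w"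
  proof -
    have eq: "(\<lambda>n. (0 ^ n / fact n) *\<^sub>R (A ^^ n) w) = (\<lambda>n. if n = 0 then w else 0)"
      by (auto simp: fun_eq_iff power_0_left)
    show ?thesis
      unfolding e_def eq using sums_unique[OF sums_single[of 0 "\<lambda>_. w"]] by simp
  qed
  have Ae: "A (e t) = (\<Sum>n. (t ^ n / fact n) *\<^sub>R (A ^^ Suc n) w)" for t
    using A.suminf[OF sm[of t]] by (simp add: e_def A.scaleR)
  have smA: "summable (\<lambda>n. (t ^ n / fact n) *\<^sub>R (A ^^ Suc n) w)" for t :: real
    using A.summable[OF sm[of t]] by (simp add: A.scaleR)
  have deriv: "(e has_vector_derivative A (e t)) (at t)" for t
    unfolding has_vector_derivative_def
  proof (subst has_derivative_componentwise_within, intro ballI)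
    fix b :: 'a assume b: "b \<in> Basis"
    define c where "c n = ((A ^^ n) w \<bullet> b) / fact n" for n
    have eb: "e t \<bullet> b = (\<Sum>n. c n * t ^ n)" for t
      unfolding e_def c_def
      using bounded_linear.suminf[OF bounded_linear_inner_left sm, of t b] by (simp add: mult_ac)
    have smc: "summable (\<lambda>n. c n * t ^ n)" for t
      unfolding c_def
      using bounded_linear.summable[OF bounded_linear_inner_left sm, of t b] by (simp add: mult_ac)
    have "diffs c n = ((A ^^ Suc n) w \<bullet> b) / fact n" for n
      by (simp add: diffs_def c_def del: of_nat_Suc)
    then have Aeb: "A (e t) \<bullet> b = (\<Sum>n. diffs c n * t ^ n)"
      using bounded_linear.suminf[OF bounded_linear_inner_left smA, of t b] by (simp add: Ae mult_ac)
    have "((\<lambda>t. e t \<bullet> b) has_field_derivative A (e t) \<bullet> b) (at t)"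
      unfolding eb Aeb by (rule termdiffs_strong_converges_everywhere[OF smc])
    then show "((\<lambda>x. e x \<bullet> b) has_derivative (\<lambda>x. x *\<^sub>R A (e t) \<bullet> b)) (at t)"
      unfolding has_field_derivative_def
      by (rule has_derivative_eq_rhs) (simp add: fun_eq_iff mult.commute)
  qed
  show thesis
  proof (rule that[of "\<lambda>t. e (t - s)"])
    fix t
    have "((\<lambda>t. t - s) has_vector_derivative 1) (at t)"
      by (auto intro!: derivative_eq_intros)
    then show "((\<lambda>t. e (t - s)) has_vector_derivative A (e (t - s))) (at t)"
      using vector_diff_chain_at[of "\<lambda>t. t - s" 1 t e "A (e (t - s))"] deriv
      by (auto simp: o_def)
  qed (simp add: e0)
qed

text \<open>The exceptional set is finite because switching signals have finitely many jumps on a bounded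
  interval. Continuity is required at the exceptional points too, so that solutions on adjacent
  intervals can be joined.\<close>

definition solves_on ::
    "(real \<Rightarrow> 'a \<Rightarrow> 'a::real_normed_vector) \<Rightarrow> real \<Rightarrow> real \<Rightarrow> (real \<Rightarrow> 'a) \<Rightarrow> bool" where
  "solves_on F a b z \<longleftrightarrow> continuous_on {a..b} z \<and>
     (\<exists>S. finite S \<and> (\<forall>t\<in>{a<..<b} - S. (z has_vector_derivative F t (z t)) (at t)))"

lemma solves_on_cong:
  assumes z: "solves_on F a b z" and eq: "\<And>t. a \<le> t \<Longrightarrow> t \<le> b \<Longrightarrow> z t = z' t"
  shows "solves_on F a b z'"
proof -
  obtain S where S: "finite S" "\<And>t. t \<in> {a<..<b} - S \<Longrightarrow> (z has_vector_derivative F t (z t)) (at t)"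
    using z by (auto simp: solves_on_def)
  have "(z' has_vector_derivative F t (z' t)) (at t)" if t: "t \<in> {a<..<b} - S" for t
    by (rule has_vector_derivative_transform_within_open[where S = "{a<..<b}" and f = z])
       (use S(2)[OF t] t eq in auto)
  moreover have "continuous_on {a..b} z'"
    using z eq by (metis atLeastAtMost_iff continuous_on_cong solves_on_def)
  ultimately show ?thesis using S(1) by (auto simp: solves_on_def)
qed

lemma solves_on_glue:
  assumes z1: "solves_on F a b z1" and z2: "solves_on F b c z2" and eq: "z1 b = z2 b"
    and "a \<le> b" "b \<le> c"
  shows "solves_on F a c (\<lambda>t. if t \<le> b then z1 t else z2 t)"
proof -
  define z where "z = (\<lambda>t. if t \<le> b then z1 t else z2 t)"
  have s1: "solves_on F a b z" by (rule solves_on_cong[OF z1]) (auto simp: z_def)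
  have s2: "solves_on F b c z" by (rule solves_on_cong[OF z2]) (use eq in \<open>auto simp: z_def\<close>)
  have "{a..c} = {a..b} \<union> {b..c}" using \<open>a \<le> b\<close> \<open>b \<le> c\<close> by auto
  then have cont: "continuous_on {a..c} z"
    using s1 s2 by (auto simp only: solves_on_def intro!: continuous_on_closed_Un)
  obtain S1 S2 where S: "finite S1" "finite S2"
    "\<And>t. t \<in> {a<..<b} - S1 \<Longrightarrow> (z has_vector_derivative F t (z t)) (at t)"
    "\<And>t. t \<in> {b<..<c} - S2 \<Longrightarrow> (z has_vector_derivative F t (z t)) (at t)"
    using s1 s2 unfolding solves_on_def by meson
  have "finite (insert b (S1 \<union> S2))" using S by simp
  moreover have "(z has_vector_derivative F t (z t)) (at t)"
    if "t \<in> {a<..<c} - insert b (S1 \<union> S2)" for t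
    using S(3)[of t] S(4)[of t] that by (cases "t < b") auto
  ultimately show ?thesis using cont unfolding solves_on_def z_def[symmetric] by blast
qed

text \<open>By the one-sided limits in a discrete space, \<open>q\<close> is constant immediately before and immediately
  after every time. So the equation has constant coefficients on both sides of every point, and
  bisection reduces the interval to such pieces. The initial value is quantified inside the
  bisected property, since each piece starts where the previous one ended.\<close>

lemma piecewise_constant_solvable:
  fixes A :: "'q::discrete_topology \<Rightarrow> 'a::euclidean_space \<Rightarrow> 'a" and q :: "real \<Rightarrow> 'q"
  assumes lin: "\<And>i. linear (A i)"
    and ql: "\<And>t. 0 < t \<Longrightarrow> \<exists>l. (q \<longlongrightarrow> l) (at_left t)"
    and qr: "\<And>t. 0 \<le> t \<Longrightarrow> \<exists>l. (q \<longlongrightarrow> l) (at_right t)"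
    and ab: "0 \<le> a" "a \<le> b"
  obtains z where "z a = w" "solves_on (\<lambda>t. A (q t)) a b z"
proof -
  let ?P = "\<lambda>a b. 0 \<le> a \<and> a \<le> b \<longrightarrow> (\<forall>w. \<exists>z. z a = w \<and> solves_on (\<lambda>t. A (q t)) a b z)"
  have trans: "?P a c" if ab: "?P a b" and bc: "?P b c" and le: "a \<le> b" "b \<le> c" for a b c
  proof (intro impI allI)
    fix w assume a: "0 \<le> a \<and> a \<le> c"
    obtain z1 where z1: "z1 a = w" "solves_on (\<lambda>t. A (q t)) a b z1" using ab a le by blast
    obtain z2 where z2: "z2 b = z1 b" "solves_on (\<lambda>t. A (q t)) b c z2"
      using bc a le by (meson order_trans)
    show "\<exists>z. z a = w \<and> solves_on (\<lambda>t. A (q t)) a c z"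
      using solves_on_glue[OF z1(2) z2(2)] z1(1) z2(1) le
      by (intro exI[of _ "\<lambda>t. if t \<le> b then z1 t else z2 t"]) auto
  qed
  have const: "?P a b" if "\<And>t. a < t \<Longrightarrow> t < b \<Longrightarrow> q t = l" for a b l
  proof (intro impI allI)
    fix w
    obtain z where z: "z a = w" "\<And>t. (z has_vector_derivative A l (z t)) (at t)"
      using linear_ode_solution[OF lin] by blast
    have "continuous_on {a..b} z"
      by (intro continuous_at_imp_continuous_on ballI has_vector_derivative_continuous[OF z(2)])
    then have "solves_on (\<lambda>t. A (q t)) a b z"
      using z(2) that unfolding solves_on_def by (intro conjI exI[of _ "{}"]) auto
    then show "\<exists>z. z a = w \<and> solves_on (\<lambda>t. A (q t)) a b z" using z(1) by blast
  qed
  have "?P a b"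
  proof (rule Bolzano[of a b ?P, OF ab(2) trans])
    fix x assume "a \<le> x" "x \<le> b"
    then have x: "0 \<le> x" using ab by simp
    obtain l where "(q \<longlongrightarrow> l) (at_right x)" using qr[OF x] by blast
    then have "eventually (\<lambda>t. q t = l) (at_right x)" by (simp add: tendsto_discrete)
    then obtain d1 where d1: "d1 > x" "\<And>t. x < t \<Longrightarrow> t < d1 \<Longrightarrow> q t = l"
      by (auto simp: eventually_at_right_field)
    have "\<exists>d2 l'. d2 < x \<and> (\<forall>t. 0 \<le> t \<and> d2 < t \<and> t < x \<longrightarrow> q t = l')"
    proof (cases "x = 0")
      case False
      then obtain l' where "(q \<longlongrightarrow> l') (at_left x)" using ql x by fastforce
      then have "eventually (\<lambda>t. q t = l') (at_left x)" by (simp add: tendsto_discrete)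
      then show ?thesis by (auto simp: eventually_at_left_field)
    next
      case True
      then show ?thesis by (intro exI[of _ "-1"]) auto
    qed
    then obtain d2 l' where d2: "d2 < x" "\<And>t. 0 \<le> t \<Longrightarrow> d2 < t \<Longrightarrow> t < x \<Longrightarrow> q t = l'" by blast
    have "?P a b" if "a \<le> x" "x \<le> b" "b - a < min (d1 - x) (x - d2)" for a b
    proof (cases "0 \<le> a")
      case True
      have "?P a x" by (rule const) (use d2 that True in auto)
      moreover have "?P x b" by (rule const) (use d1 that in auto)
      ultimately show ?thesis using trans that by blast
    qed simp
    then show "\<exists>d>0. \<forall>a b. a \<le> x \<and> x \<le> b \<and> b - a < d \<longrightarrow> ?P a b"
      using d1(1) d2(1) by (intro exI[of _ "min (d1 - x) (x - d2)"]) auto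
  qed
  then show thesis using that ab by blast
qed

text \<open>The solution on \<open>{0..n + 1}\<close> is chosen as an extension of the one on \<open>{0..n}\<close>, so that all of
  them are restrictions of a single function.\<close>

lemma piecewise_constant_solvable_global:
  fixes A :: "'q::discrete_topology \<Rightarrow> 'a::euclidean_space \<Rightarrow> 'a" and q :: "real \<Rightarrow> 'q"
  assumes lin: "\<And>i. linear (A i)"
    and ql: "\<And>t. 0 < t \<Longrightarrow> \<exists>l. (q \<longlongrightarrow> l) (at_left t)"
    and qr: "\<And>t. 0 \<le> t \<Longrightarrow> \<exists>l. (q \<longlongrightarrow> l) (at_right t)"
  obtains z where "z 0 = w" "\<And>n::nat. solves_on (\<lambda>t. A (q t)) 0 (real n) z"
proof -
  let ?S = "solves_on (\<lambda>t. A (q t))"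
  have ex: "\<exists>z. z a = w \<and> ?S a b z" if "0 \<le> a" "a \<le> b" for a b w
    using piecewise_constant_solvable[where A = A and q = q and w = w, OF lin ql qr that] by metis
  have "\<exists>f. \<forall>n. (f n 0 = w \<and> ?S 0 (real n) (f n)) \<and> (\<forall>t\<le>real n. f (Suc n) t = f n t)"
  proof (rule dependent_nat_choice)
    show "\<exists>z. z 0 = w \<and> ?S 0 (real 0) z"
      using ex[of 0 0] by simp
  next
    fix z n assume z: "z 0 = w \<and> ?S 0 (real n) z"
    obtain z' where z': "z' (real n) = z (real n)" "?S (real n) (real (Suc n)) z'"
      using ex[of "real n" "real (Suc n)"] by auto
    show "\<exists>y. (y 0 = w \<and> ?S 0 (real (Suc n)) y) \<and> (\<forall>t\<le>real n. y t = z t)"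
      using solves_on_glue[of _ 0 "real n" z "real (Suc n)" z'] z z'
      by (intro exI[of _ "\<lambda>t. if t \<le> real n then z t else z' t"]) auto
  qed
  then obtain f where f: "\<And>n. f n 0 = w" "\<And>n. ?S 0 (real n) (f n)"
    "\<And>n t. t \<le> real n \<Longrightarrow> f (Suc n) t = f n t" by blast
  have mono: "f m t = f n t" if "n \<le> m" "t \<le> real n" for m n t
    using that by (induction m rule: dec_induct) (use f(3) in auto)
  define z where "z t = f (nat \<lceil>t\<rceil>) t" for t
  have zf: "f n t = z t" if "0 \<le> t" "t \<le> real n" for n t
    unfolding z_def using that by (intro mono) (auto simp: nat_le_iff ceiling_le_iff)
  show thesis
  proof (rule that[of z])
    show "z 0 = w" using f(1) zf[of 0 0] by simp
    show "?S 0 (real n) z" for n by (rule solves_on_cong[OF f(2)]) (use zf in auto)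
  qed
qed

section \<open>Free motions and unobservable states\<close>

text \<open>Outside finitely many points the derivative of the solution is bounded on every compact
  interval, so the solution is Lipschitz there and hence absolutely continuous.\<close>

lemma ct_homogeneous_state_exists:
  fixes \<Sigma> :: "('n::finite, 'm::finite, 'p::finite) lss"
  assumes q: "q \<in> ct_switching (modes \<Sigma>)"
  shows "\<exists>z. z \<in> ct_state \<Sigma> w (\<lambda>_. 0) q"
proof -
  have qm: "q t \<in> modes \<Sigma>" if "0 \<le> t" for t using q that by (auto simp: ct_switching_def)
  have ql: "\<exists>l. (q \<longlongrightarrow> l) (at_left t)" if "0 < t" for t using q that by (auto simp: ct_switching_def)
  have qr: "\<exists>l. (q \<longlongrightarrow> l) (at_right t)" if "0 \<le> t" for t using q that by (auto simp: ct_switching_def)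
  let ?F = "\<lambda>t x. Amat \<Sigma> (q t) *v x"
  obtain z where z0: "z 0 = w" and z: "\<And>n::nat. solves_on ?F 0 (real n) z"
    using piecewise_constant_solvable_global[where A = "\<lambda>i. (*v) (Amat \<Sigma> i)" and q = q and w = w,
        OF matrix_vector_mul_linear ql qr] by metis
  then obtain S where S: "\<And>n. finite (S n)"
    "\<And>n t. t \<in> {0<..<real n} - S n \<Longrightarrow> (z has_vector_derivative ?F t (z t)) (at t)"
    unfolding solves_on_def by metis
  obtain M where M0: "0 \<le> M" and M: "\<And>i x. i \<in> modes \<Sigma> \<Longrightarrow> norm (Amat \<Sigma> i *v x) \<le> M * norm x"
    using finite_linear_family_bound[of "modes \<Sigma>" "\<lambda>i x. Amat \<Sigma> i *v x"] finite_modes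
      matrix_vector_mul_linear by metis
  have ac: "absolutely_continuous_on_interval 0 b z" if "0 \<le> b" for b
  proof -
    obtain n :: nat where n: "b \<le> real n" using real_arch_simple by blast
    have cont: "continuous_on {0..real n} z" using z by (simp add: solves_on_def)
    then have "compact (z ` {0..real n})" by (rule compact_continuous_image) simp
    then obtain B where B: "\<And>t. t \<in> {0..real n} \<Longrightarrow> norm (z t) \<le> B"
      using compact_imp_bounded bounded_iff by (metis imageI)
    have B0: "0 \<le> B" using B[of 0] by (simp add: order_trans[OF norm_ge_zero])
    have lip: "norm (z t - z s) \<le> (B * M) * (t - s)" if st: "0 \<le> s" "s < t" "t \<le> b" for s t
    proof -
      have "((\<lambda>t. ?F t (z t)) has_integral (z t - z s)) (cbox s t)"
        unfolding cbox_interval by (rule fundamental_theorem_of_calculus_interior_strong[OF S(1)[of n]])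
           (use st n S(2)[of _ n] in \<open>auto intro: continuous_on_subset[OF cont]\<close>)
      then have "norm (z t - z s) \<le> (B * M) * measure lborel (cbox s t)"
      proof (rule has_integral_bound[rotated])
        fix r assume "r \<in> cbox s t"
        then have r: "r \<in> {s..t}" by simp
        have "norm (?F r (z r)) \<le> M * norm (z r)" using M qm r st by simp
        also have "\<dots> \<le> M * B" using B[of r] r st n M0 by (intro mult_left_mono) auto
        also have "\<dots> = B * M" by (rule mult.commute)
        finally show "norm (?F r (z r)) \<le> B * M" .
      qed (use B0 M0 in auto)
      then show ?thesis using st by simp
    qed
    show ?thesis
    proof (rule absolutely_continuous_dominated[OF absolutely_continuous_ident absolutely_continuous_ident])
      fix s t :: real assume st: "0 \<le> s" "s < t" "t \<le> b"
      have "(B * M) * (t - s) \<le> (B * M) * (norm (t - s) + norm (t - s))"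
        using B0 M0 st by (intro mult_left_mono) auto
      with lip[OF st] show "norm (z t - z s) \<le> (B * M) * (norm (t - s) + norm (t - s))"
        by (rule order_trans)
    qed
  qed
  have "negligible (insert 0 (\<Union>n. S n))"
    using S(1) by (auto intro: negligible_Union_nat)
  then have "AE t in lebesgue. t \<in> {0..} \<longrightarrow>
      (z has_vector_derivative (?F t (z t) + Bmat \<Sigma> (q t) *v 0)) (at t within {0..})"
    unfolding eventually_ae_filter_negligible
  proof (intro exI conjI subsetI)
    fix t assume "t \<in> {t. \<not> (t \<in> {0..} \<longrightarrow>
      (z has_vector_derivative (?F t (z t) + Bmat \<Sigma> (q t) *v 0)) (at t within {0..}))}"
    then have t: "0 \<le> t" "\<not> (z has_vector_derivative ?F t (z t)) (at t)"
      using has_vector_derivative_at_within by auto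
    obtain n :: nat where "t < real n" using reals_Archimedean2 by blast
    then show "t \<in> insert 0 (\<Union>n. S n)" using S(2)[of t n] t by fastforce
  qed
  then have "AE t in lebesgue_on {0..}.
      (z has_vector_derivative (?F t (z t) + Bmat \<Sigma> (q t) *v 0)) (at t within {0..})"
    by (subst AE_restrict_space_iff) auto
  then show ?thesis using ac z0 by (auto simp: ct_state_def)
qed

lemma ct_state_add:
  assumes x: "x \<in> ct_state \<Sigma> x0 u q" and z: "z \<in> ct_state \<Sigma> z0 v q"
  shows "(\<lambda>t. x t + z t) \<in> ct_state \<Sigma> (x0 + z0) (\<lambda>t. u t + v t) q"
proof -
  have "absolutely_continuous_on_interval 0 b (\<lambda>t. x t + z t)" if "0 \<le> b" for b
  proof (rule absolutely_continuous_dominated[where C = 1])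
    show "absolutely_continuous_on_interval 0 b x" "absolutely_continuous_on_interval 0 b z"
      using x z that by (auto simp: ct_state_def)
    show "norm ((x t + z t) - (x s + z s)) \<le> 1 * (norm (x t - x s) + norm (z t - z s))" for s t
      using norm_triangle_ineq[of "x t - x s" "z t - z s"] by (simp add: algebra_simps)
  qed
  moreover have "AE t in lebesgue_on {0..}. ((\<lambda>t. x t + z t) has_vector_derivative
      (Amat \<Sigma> (q t) *v (x t + z t) + Bmat \<Sigma> (q t) *v (u t + v t))) (at t within {0..})"
  proof -
    have "AE t in lebesgue_on {0..}. (x has_vector_derivative
        (Amat \<Sigma> (q t) *v x t + Bmat \<Sigma> (q t) *v u t)) (at t within {0..})"
      and "AE t in lebesgue_on {0..}. (z has_vector_derivative
        (Amat \<Sigma> (q t) *v z t + Bmat \<Sigma> (q t) *v v t)) (at t within {0..})"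
      using x z by (auto simp: ct_state_def)
    then show ?thesis
    proof eventually_elim
      case (elim t)
      show ?case using has_vector_derivative_add[OF elim]
        by (simp add: matrix_vector_right_distrib algebra_simps)
    qed
  qed
  ultimately show ?thesis using x z by (auto simp: ct_state_def)
qed

text \<open>A free motion that starts in \<open>V\<close> stays in \<open>V\<close> and is invisible in the output. Adding it to a
  trajectory with initial state \<open>x0\<close> gives one with initial state \<open>x0 + v\<close> and the same output.
  Since \<open>ct_output\<close> is a set, the outputs for \<open>w\<close> and \<open>0\<close> agree only if the output of each
  trajectory from one state is also the output of a trajectory from the other; this is where the
  existence of free motions enters, once for \<open>w\<close> and once for \<open>- w\<close>.\<close>

lemma ct_unobservable_subspace:
  fixes \<Sigma> :: "('n::finite, 'm::finite, 'p::finite) lss"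
  assumes V: "subspace V"
    and AV: "\<And>q x. q \<in> modes \<Sigma> \<Longrightarrow> x \<in> V \<Longrightarrow> Amat \<Sigma> q *v x \<in> V"
    and CV: "\<And>q x. q \<in> modes \<Sigma> \<Longrightarrow> x \<in> V \<Longrightarrow> Cmat \<Sigma> q *v x = 0"
    and obs: "ct_observable \<Sigma>" and w: "w \<in> V"
  shows "w = 0"
proof (rule ccontr)
  assume "w \<noteq> 0"
  then obtain u q where q: "q \<in> ct_switching (modes \<Sigma>)"
    and ne: "ct_output \<Sigma> w u q \<noteq> ct_output \<Sigma> 0 u q"
    using obs unfolding ct_observable_def by blast
  have qm: "q t \<in> modes \<Sigma>" if "0 \<le> t" for t using q that by (auto simp: ct_switching_def)
  have shift: "ct_output \<Sigma> x0 u q \<subseteq> ct_output \<Sigma> (x0 + v) u q" if v: "v \<in> V" for x0 v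
  proof
    fix y assume "y \<in> ct_output \<Sigma> x0 u q"
    then obtain x where x: "x \<in> ct_state \<Sigma> x0 u q" and y: "y = (\<lambda>t\<in>{0..}. Cmat \<Sigma> (q t) *v x t)"
      by (auto simp: ct_output_def)
    obtain z where z: "z \<in> ct_state \<Sigma> v (\<lambda>_. 0) q"
      using ct_homogeneous_state_exists[OF q] by blast
    have "z t \<in> V" if "0 \<le> t" for t
      by (rule ct_state_in_invariant_subspace[OF V AV qm _ z v that]) (use V in \<open>auto simp: subspace_0\<close>)
    then have "y = (\<lambda>t\<in>{0..}. Cmat \<Sigma> (q t) *v (x t + z t))"
      using CV qm by (auto simp: y fun_eq_iff restrict_def matrix_vector_right_distrib)
    then show "y \<in> ct_output \<Sigma> (x0 + v) u q"
      using ct_state_add[OF x z] by (auto simp: ct_output_def)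
  qed
  have "- w \<in> V" using V w by (rule subspace_neg)
  then show False using shift[OF w, of 0] shift[of "- w" w] ne by simp
qed

lemma dt_state_in_invariant_subspace:
  fixes \<Sigma> :: "('n::finite, 'm::finite, 'p::finite) lss"
  assumes W: "subspace W"
    and AW: "\<And>q x. q \<in> modes \<Sigma> \<Longrightarrow> x \<in> W \<Longrightarrow> Amat \<Sigma> q *v x \<in> W"
    and q: "\<And>t. q t \<in> modes \<Sigma>"
    and BW: "\<And>t. Bmat \<Sigma> (q t) *v u t \<in> W"
    and x0: "x0 \<in> W"
  shows "dt_state \<Sigma> x0 u q t \<in> W"
  by (induction t) (auto intro: x0 subspace_add[OF W] AW q BW)

lemma dt_state_add:
  "dt_state \<Sigma> (x0 + z0) (\<lambda>t. u t + v t) q t = dt_state \<Sigma> x0 u q t + dt_state \<Sigma> z0 v q t"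
  by (induction t) (simp_all add: matrix_vector_right_distrib algebra_simps)

lemma dt_unobservable_subspace:
  fixes \<Sigma> :: "('n::finite, 'm::finite, 'p::finite) lss"
  assumes V: "subspace V"
    and AV: "\<And>q x. q \<in> modes \<Sigma> \<Longrightarrow> x \<in> V \<Longrightarrow> Amat \<Sigma> q *v x \<in> V"
    and CV: "\<And>q x. q \<in> modes \<Sigma> \<Longrightarrow> x \<in> V \<Longrightarrow> Cmat \<Sigma> q *v x = 0"
    and obs: "dt_observable \<Sigma>" and w: "w \<in> V"
  shows "w = 0"
proof (rule ccontr)
  assume "w \<noteq> 0"
  then obtain u q where q: "q \<in> dt_switching (modes \<Sigma>)"
    and ne: "dt_output \<Sigma> w u q \<noteq> dt_output \<Sigma> 0 u q"
    using obs unfolding dt_observable_def by blast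
  have qm: "q t \<in> modes \<Sigma>" for t using q by (auto simp: dt_switching_def)
  have "dt_state \<Sigma> w (\<lambda>_. 0) q t \<in> V" for t
    by (rule dt_state_in_invariant_subspace[OF V AV qm _ w]) (use V in \<open>auto simp: subspace_0\<close>)
  then have "dt_output \<Sigma> w u q = dt_output \<Sigma> 0 u q"
    using dt_state_add[of \<Sigma> 0 w u "\<lambda>_. 0" q] CV qm
    by (auto simp: dt_output_def fun_eq_iff matrix_vector_right_distrib)
  then show False using ne by simp
qed

section \<open>Kernels of solutions of Lyapunov inequalities\<close>

text \<open>A vector with \<open>v \<bullet> (M *v v) = 0\<close> minimises the quadratic form, so the form cannot decrease along
  the line through \<open>v\<close> in the direction \<open>M *v v\<close>.\<close>

lemma pos_semidef_kernel:
  assumes M: "pos_semidef M" and v: "v \<bullet> (M *v v) = 0"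
  shows "M *v v = 0"
proof -
  let ?w = "M *v v"
  define c where "c = ?w \<bullet> ?w"
  define d where "d = ?w \<bullet> (M *v ?w)"
  have d: "0 \<le> d" using M by (simp add: pos_semidef_def d_def)
  have "v \<bullet> (M *v ?w) = (v v* M) \<bullet> ?w" by (simp add: dot_lmul_matrix)
  also have "v v* M = transpose M *v v" by simp
  also have "\<dots> = ?w" using M by (simp only: pos_semidef_def)
  finally have sym: "v \<bullet> (M *v ?w) = c" by (simp add: c_def)
  have "0 \<le> (v + t *\<^sub>R ?w) \<bullet> (M *v (v + t *\<^sub>R ?w))" for t
    using M by (simp add: pos_semidef_def)
  then have quad: "0 \<le> 2 * t * c + t * t * d" for t
    using v sym by (simp add: matrix_vector_right_distrib matrix_vector_mult_scaleR inner_add_left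
        inner_add_right c_def d_def algebra_simps)
  \<comment> \<open>The minimiser \<open>t = - c / d\<close> may be undefined; \<open>d + 1\<close> in its place still gives a value of
    the sign of \<open>- c\<^sup>2\<close>.\<close>
  have "0 \<le> 2 * (- c / (d + 1)) * c + (- c / (d + 1)) * (- c / (d + 1)) * d" by (rule quad)
  also have "\<dots> = - (c\<^sup>2 * (d + 2) / (d + 1)\<^sup>2)"
    using d by (simp add: divide_simps) (simp add: power2_eq_square algebra_simps)
  finally have "c\<^sup>2 * (d + 2) / (d + 1)\<^sup>2 \<le> 0" by simp
  then have "c = 0" using d by (simp add: divide_le_0_iff mult_le_0_iff)
  then show ?thesis by (simp add: c_def)
qed

lemma neg_semidef_kernel:
  assumes M: "neg_semidef M" and v: "v \<bullet> (M *v v) = 0"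
  shows "M *v v = 0"
proof -
  have neg: "(- M) *v x = - (M *v x)" for x
    using matrix_vector_mult_diff_rdistrib[of 0 M x] by simp
  have "transpose (- M) = - transpose M" by (simp add: transpose_def vec_eq_iff)
  then have "pos_semidef (- M)" using M by (simp add: neg_semidef_def pos_semidef_def neg)
  from pos_semidef_kernel[OF this, of v] show ?thesis using v by (simp add: neg)
qed

lemma pos_def_if_trivial_kernel:
  assumes "pos_semidef M" "\<And>v. M *v v = 0 \<Longrightarrow> v = 0"
  shows "pos_def M"
  using assms pos_semidef_kernel[OF assms(1)] unfolding pos_def_def pos_semidef_def
  by (metis order_le_less)

lemma kernel_symmetric_inner:
  fixes P :: "real ^ 'n ^ 'n"
  assumes "pos_semidef P" "P *v v = 0"
  shows "v \<bullet> (P *v y) = 0"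
proof -
  have "v v* P = transpose P *v v" by simp
  also have "\<dots> = 0" using assms by (simp only: pos_semidef_def)
  finally show ?thesis by (simp flip: dot_lmul_matrix)
qed

text \<open>At \<open>v\<close> in the kernel of \<open>P\<close> both drift terms of the quadratic form of the Lyapunov matrix vanish
  and only the squared norm of \<open>transpose B *v v\<close> remains. It cannot be positive, so it is \<open>0\<close>.
  But then the semidefinite form attains its extreme value at \<open>v\<close>, so the Lyapunov matrix itself
  kills \<open>v\<close>, and what is left of it at \<open>v\<close> is \<open>P *v (transpose A *v v)\<close>. The observability case is
  the same statement for \<open>transpose A\<close> and \<open>transpose C\<close>.\<close>

lemma ct_lyapunov_kernel:
  fixes P :: "real ^ 'n ^ 'n" and A :: "real ^ 'n ^ 'n" and B :: "real ^ 'm ^ 'n"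
  assumes P: "pos_semidef P" and v: "P *v v = 0"
    and lyap: "neg_semidef (A ** P + P ** transpose A + B ** transpose B)"
  shows "transpose B *v v = 0" "P *v (transpose A *v v) = 0"
proof -
  let ?M = "A ** P + P ** transpose A + B ** transpose B"
  have Mv: "?M *v v = P *v (transpose A *v v) + B *v (transpose B *v v)"
    using v by (simp add: matrix_vector_mult_add_rdistrib del: transpose_matrix_vector
        flip: matrix_vector_mul_assoc)
  have eq: "v \<bullet> (?M *v v) = (transpose B *v v) \<bullet> (transpose B *v v)"
    using kernel_symmetric_inner[OF P v, of "transpose A *v v"]
    by (simp add: Mv inner_add_right flip: dot_lmul_matrix)
  have "v \<bullet> (?M *v v) \<le> 0" using lyap by (metis neg_semidef_def)
  then have "(transpose B *v v) \<bullet> (transpose B *v v) = 0"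
    using eq by (metis inner_ge_zero order_antisym)
  then show "transpose B *v v = 0" "P *v (transpose A *v v) = 0"
    using neg_semidef_kernel[OF lyap, of v] eq Mv by (simp_all del: transpose_matrix_vector)
qed

text \<open>Here the quadratic form at \<open>v\<close> is a sum of two nonnegative terms, so both vanish; the first is
  the form of \<open>P\<close> at \<open>transpose A *v v\<close>.\<close>

lemma dt_lyapunov_kernel:
  fixes P :: "real ^ 'n ^ 'n" and A :: "real ^ 'n ^ 'n" and B :: "real ^ 'm ^ 'n"
  assumes P: "pos_semidef P" and v: "P *v v = 0"
    and lyap: "neg_semidef (A ** P ** transpose A + B ** transpose B - P)"
  shows "transpose B *v v = 0" "P *v (transpose A *v v) = 0"
proof -
  let ?M = "A ** P ** transpose A + B ** transpose B - P"
  let ?a = "transpose A *v v"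
  have "?M *v v = A *v (P *v ?a) + B *v (transpose B *v v)"
    using v by (simp add: matrix_vector_mult_add_rdistrib matrix_vector_mult_diff_rdistrib
        del: transpose_matrix_vector flip: matrix_vector_mul_assoc)
  then have "v \<bullet> (?M *v v) = ?a \<bullet> (P *v ?a) + (transpose B *v v) \<bullet> (transpose B *v v)"
    by (simp add: inner_add_right flip: dot_lmul_matrix)
  then have "?a \<bullet> (P *v ?a) + (transpose B *v v) \<bullet> (transpose B *v v) \<le> 0"
    using lyap by (metis neg_semidef_def)
  moreover have "0 \<le> ?a \<bullet> (P *v ?a)" using P by (metis pos_semidef_def)
  moreover have "0 \<le> (transpose B *v v) \<bullet> (transpose B *v v)" by (rule inner_ge_zero)
  ultimately have "?a \<bullet> (P *v ?a) = 0" "(transpose B *v v) \<bullet> (transpose B *v v) = 0" by linarith+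
  then show "transpose B *v v = 0" "P *v ?a = 0"
    using pos_semidef_kernel[OF P, of ?a] by (simp_all del: transpose_matrix_vector)
qed

text \<open>Duality: a subspace that the transposes preserve and annihilate has an orthogonal complement
  that is preserved by \<open>A\<close> and contains the range of \<open>B\<close>.\<close>

lemma annihilator_invariant:
  fixes P :: "real ^ 'n ^ 'n" and A :: "real ^ 'n ^ 'n" and B :: "real ^ 'm ^ 'n"
  assumes "\<And>v. P *v v = 0 \<Longrightarrow> transpose B *v v = 0" "\<And>v. P *v v = 0 \<Longrightarrow> P *v (transpose A *v v) = 0"
    and "x \<in> {v. P *v v = 0}\<^sup>\<bottom>"
  shows "A *v x \<in> {v. P *v v = 0}\<^sup>\<bottom>" "B *v u \<in> {v. P *v v = 0}\<^sup>\<bottom>"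
  using assms
  by (auto simp: orthogonal_comp_def orthogonal_def simp flip: dot_lmul_matrix)

lemma trivial_kernel_if_spanning:
  fixes P :: "real ^ 'n ^ 'n"
  assumes "S \<subseteq> {v. P *v v = 0}\<^sup>\<bottom>" "span S = UNIV" "P *v v = 0"
  shows "v = 0"
proof -
  have "UNIV \<subseteq> {v. P *v v = 0}\<^sup>\<bottom>"
    using assms(1,2) span_minimal[OF _ subspace_orthogonal_comp] by metis
  then have "v \<in> {v. P *v v = 0}\<^sup>\<bottom>" by blast
  then show ?thesis using assms(3) by (auto simp: orthogonal_comp_def orthogonal_def)
qed

section \<open>Definiteness from reachability and observability\<close>

lemma ct_controllability_pos_def:
  fixes \<Sigma> :: "('n::finite, 'm::finite, 'p::finite) lss"
  assumes P: "pos_semidef P"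
    and lyap: "\<And>q. q \<in> modes \<Sigma> \<Longrightarrow> neg_semidef
           (Amat \<Sigma> q ** P + P ** transpose (Amat \<Sigma> q) + Bmat \<Sigma> q ** transpose (Bmat \<Sigma> q))"
    and reach: "ct_span_reachable \<Sigma>"
  shows "pos_def P"
proof -
  let ?W = "{v. P *v v = 0}\<^sup>\<bottom>"
  note ker = ct_lyapunov_kernel[OF P _ lyap]
  have inv: "Amat \<Sigma> q *v x \<in> ?W" "Bmat \<Sigma> q *v u \<in> ?W" if "q \<in> modes \<Sigma>" "x \<in> ?W" for q x u
    using annihilator_invariant[OF ker(1)[OF _ that(1)] ker(2)[OF _ that(1)] that(2)] by blast+
  have W: "subspace ?W" by (rule subspace_orthogonal_comp)
  have "ct_reachable \<Sigma> \<subseteq> ?W"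
  proof
    fix y assume "y \<in> ct_reachable \<Sigma>"
    then obtain x u q t where y: "y = x t" and q: "q \<in> ct_switching (modes \<Sigma>)"
      and x: "x \<in> ct_state \<Sigma> 0 u q" and t: "0 \<le> t"
      unfolding ct_reachable_def by blast
    have qm: "q t \<in> modes \<Sigma>" if "0 \<le> t" for t using q that by (auto simp: ct_switching_def)
    show "y \<in> ?W"
      unfolding y
      by (rule ct_state_in_invariant_subspace[OF W inv(1) qm inv(2)[OF qm] x _ t])
         (auto intro: subspace_0[OF W])
  qed
  from trivial_kernel_if_spanning[OF this] show ?thesis
    using reach by (intro pos_def_if_trivial_kernel[OF P]) (auto simp: ct_span_reachable_def)
qed

lemma dt_controllability_pos_def:
  fixes \<Sigma> :: "('n::finite, 'm::finite, 'p::finite) lss"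
  assumes P: "pos_semidef P"
    and lyap: "\<And>q. q \<in> modes \<Sigma> \<Longrightarrow> neg_semidef
           (Amat \<Sigma> q ** P ** transpose (Amat \<Sigma> q) + Bmat \<Sigma> q ** transpose (Bmat \<Sigma> q) - P)"
    and reach: "dt_span_reachable \<Sigma>"
  shows "pos_def P"
proof -
  let ?W = "{v. P *v v = 0}\<^sup>\<bottom>"
  note ker = dt_lyapunov_kernel[OF P _ lyap]
  have inv: "Amat \<Sigma> q *v x \<in> ?W" "Bmat \<Sigma> q *v u \<in> ?W" if "q \<in> modes \<Sigma>" "x \<in> ?W" for q x u
    using annihilator_invariant[OF ker(1)[OF _ that(1)] ker(2)[OF _ that(1)] that(2)] by blast+
  have W: "subspace ?W" by (rule subspace_orthogonal_comp)
  have "dt_reachable \<Sigma> \<subseteq> ?W"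
  proof
    fix y assume "y \<in> dt_reachable \<Sigma>"
    then obtain u q t where y: "y = dt_state \<Sigma> 0 u q t" and "q \<in> dt_switching (modes \<Sigma>)"
      unfolding dt_reachable_def by blast
    then have qm: "q t \<in> modes \<Sigma>" for t by (auto simp: dt_switching_def)
    show "y \<in> ?W"
      unfolding y
      by (rule dt_state_in_invariant_subspace[OF W inv(1) qm inv(2)[OF qm]])
         (auto intro: subspace_0[OF W])
  qed
  from trivial_kernel_if_spanning[OF this] show ?thesis
    using reach by (intro pos_def_if_trivial_kernel[OF P]) (auto simp: dt_span_reachable_def)
qed

lemma subspace_kernel_matrix: "subspace {v. R *v v = 0}" for R :: "real ^ 'n ^ 'm"
  by (rule linear_subspace_kernel) (rule matrix_vector_mul_linear)

lemma ct_observability_pos_def: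
  fixes \<Sigma> :: "('n::finite, 'm::finite, 'p::finite) lss"
  assumes R: "pos_semidef R"
    and lyap: "\<And>q. q \<in> modes \<Sigma> \<Longrightarrow> neg_semidef
           (transpose (Amat \<Sigma> q) ** R + R ** Amat \<Sigma> q + transpose (Cmat \<Sigma> q) ** Cmat \<Sigma> q)"
    and obs: "ct_observable \<Sigma>"
  shows "pos_def R"
proof (rule pos_def_if_trivial_kernel[OF R])
  have ker: "Cmat \<Sigma> q *v v = 0" "R *v (Amat \<Sigma> q *v v) = 0" if "q \<in> modes \<Sigma>" "R *v v = 0" for q v
    using ct_lyapunov_kernel[OF R that(2), of "transpose (Amat \<Sigma> q)" "transpose (Cmat \<Sigma> q)"]
      lyap[OF that(1)] by (simp_all only: transpose_transpose)
  show "v = 0" if "R *v v = 0" for v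
    by (rule ct_unobservable_subspace[OF subspace_kernel_matrix _ _ obs, of R])
       (use ker that in auto)
qed

lemma dt_observability_pos_def:
  fixes \<Sigma> :: "('n::finite, 'm::finite, 'p::finite) lss"
  assumes R: "pos_semidef R"
    and lyap: "\<And>q. q \<in> modes \<Sigma> \<Longrightarrow> neg_semidef
           (transpose (Amat \<Sigma> q) ** R ** Amat \<Sigma> q + transpose (Cmat \<Sigma> q) ** Cmat \<Sigma> q - R)"
    and obs: "dt_observable \<Sigma>"
  shows "pos_def R"
proof (rule pos_def_if_trivial_kernel[OF R])
  have ker: "Cmat \<Sigma> q *v v = 0" "R *v (Amat \<Sigma> q *v v) = 0" if "q \<in> modes \<Sigma>" "R *v v = 0" for q v
    using dt_lyapunov_kernel[OF R that(2), of "transpose (Amat \<Sigma> q)" "transpose (Cmat \<Sigma> q)"]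
      lyap[OF that(1)] by (simp_all only: transpose_transpose)
  show "v = 0" if "R *v v = 0" for v
    by (rule dt_unobservable_subspace[OF subspace_kernel_matrix _ _ obs, of R])
       (use ker that in auto)
qed

theorem theorem4:
  fixes \<Sigma> :: "('n::finite, 'm::finite, 'p::finite) lss"
  assumes "num_modes \<Sigma> \<ge> 1"
  shows
    "(\<forall>P. pos_semidef P \<and>
        (\<forall>q \<in> modes \<Sigma>. neg_semidef
           (Amat \<Sigma> q ** P + P ** transpose (Amat \<Sigma> q) + Bmat \<Sigma> q ** transpose (Bmat \<Sigma> q))) \<and>
        ct_span_reachable \<Sigma> \<longrightarrow> pos_def P) \<and>
     (\<forall>P. pos_semidef P \<and>
        (\<forall>q \<in> modes \<Sigma>. neg_semidef
           (Amat \<Sigma> q ** P ** transpose (Amat \<Sigma> q) + Bmat \<Sigma> q ** transpose (Bmat \<Sigma> q) - P)) \<and>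
        dt_span_reachable \<Sigma> \<longrightarrow> pos_def P) \<and>
     (\<forall>R. pos_semidef R \<and>
        (\<forall>q \<in> modes \<Sigma>. neg_semidef
           (transpose (Amat \<Sigma> q) ** R + R ** Amat \<Sigma> q + transpose (Cmat \<Sigma> q) ** Cmat \<Sigma> q)) \<and>
        ct_observable \<Sigma> \<longrightarrow> pos_def R) \<and>
     (\<forall>R. pos_semidef R \<and>
        (\<forall>q \<in> modes \<Sigma>. neg_semidef
           (transpose (Amat \<Sigma> q) ** R ** Amat \<Sigma> q + transpose (Cmat \<Sigma> q) ** Cmat \<Sigma> q - R)) \<and>
        dt_observable \<Sigma> \<longrightarrow> pos_def R)"
  using ct_controllability_pos_def[of _ \<Sigma>] dt_controllability_pos_def[of _ \<Sigma>]
    ct_observability_pos_def[of _ \<Sigma>] dt_observability_pos_def[of _ \<Sigma>]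
  by blast

end
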